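(* Let $k$ be a positive integer, let $(A_n)_{n\ge 0}$ and $(B_n)_{n\ge 0}$ be real sequences, and let $(u_n)_{n\ge 0}$ be a well-defined real solution of $$u_{n+4k}=\frac{u_n}{A_n+B_n\prod_{i=1}^{k}u_{n+4(i-1)}},\qquad n\ge 0,$$ with initial values $u_0,u_1,\dots,u_{4k-1}$. Then for all integers $n\ge 0$ and all $i=0,1,\dots,4k-1$, $$u_{4kn+i}=u_i\prod_{s=0}^{n-1}\frac{\left(\prod_{k_1=0}^{ks+\lfloor i/4\rfloor-1}A_{4k_1+\tau(i)}\right)+\left(\prod_{j=0}^{k-1}u_{\tau(i)+4j}\right)\sum_{l=0}^{ks+\lfloor i/4\rfloor-1}\left(B_{4l+\tau(i)}\prod_{k_2=l+1}^{ks+\lfloor i/4\rfloor-1}A_{4k_2+\tau(i)}\right)}{\left(\prod_{k_1=0}^{ks+\lfloor i/4\rfloor}A_{4k_1+\tau(i)}\right)+\left(\prod_{j=0}^{k-1}u_{\tau(i)+4j}\right)\sum_{l=0}^{ks+\lfloor i/4\rfloor}\left(B_{4l+\tau(i)}\prod_{k_2=l+1}^{ks+\lfloor i/4\rfloor}A_{4k_2+\tau(i)}\right)}.$$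
   Context: For an integer $r\ge 0$, $\tau(r)\in\{0,1,2,3\}$ denotes the remainder of $r$ on division by $4$, so $r=4\lfloor r/4\rfloor+\tau(r)$. Empty products equal $1$ and empty sums equal $0$. A solution is well-defined if every denominator $A_n+B_n\prod_{i=1}^{k}u_{n+4(i-1)}$, $n\ge 0$, is non-zero. *)

theory Defs
  imports Complex_Main
begin

definition tau :: "nat \<Rightarrow> nat" where
  "tau r = r mod 4"

definition denom :: "nat \<Rightarrow> (nat \<Rightarrow> real) \<Rightarrow> (nat \<Rightarrow> real) \<Rightarrow> (nat \<Rightarrow> real) \<Rightarrow> nat \<Rightarrow> real" where
  "denom k A B u n = A n + B n * (\<Prod>i=1..k. u (n + 4 * (i - 1)))"

definition well_defined_solution ::
    "nat \<Rightarrow> (nat \<Rightarrow> real) \<Rightarrow> (nat \<Rightarrow> real) \<Rightarrow> (nat \<Rightarrow> real) \<Rightarrow> bool" where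
  "well_defined_solution k A B u \<longleftrightarrow>
     (\<forall>n. denom k A B u n \<noteq> 0 \<and> u (n + 4 * k) = u n / denom k A B u n)"

end

theory Submission
  imports Defs
begin

text \<open>
  The order-\<open>4k\<close> equation decouples along the residue classes modulo 4: for fixed \<open>t < 4\<close> the
  sequence \<open>v m = u (4 m + t)\<close> satisfies \<open>v (m + k) = v m / d m\<close>, where \<open>d m = a m + b m * V m\<close> and
  \<open>V m\<close> is the product of the window \<open>v m, \<dots>, v (m + k - 1)\<close>. Sliding the window by one position
  trades \<open>v m\<close> for \<open>v (m + k)\<close>, so \<open>V (m + 1) = V m / d m\<close>: the nonlinear equation becomes a
  first-order one for \<open>V\<close>, and the reciprocals of \<open>V\<close> obey a linear recurrence. To allow windows
  that vanish, the argument avoids reciprocals and uses the solution \<open>N\<close> of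
  \<open>N (m + 1) = a m * N m + V 0 * b m\<close>, \<open>N 0 = 1\<close>, which is the closed form in the theorem. Then
  \<open>V m * N m = V 0\<close> is invariant, hence \<open>N (m + 1) = d m * N m\<close>; in particular \<open>N\<close> never vanishes
  and \<open>1 / d m = N m / N (m + 1)\<close> (lemma \<open>affine_solution_step\<close>). Iterating
  \<open>v (m + k) = v m * N m / N (m + 1)\<close> over \<open>m = k s + i div 4\<close> gives the product formula.
\<close>

definition affine_solution :: "(nat \<Rightarrow> real) \<Rightarrow> (nat \<Rightarrow> real) \<Rightarrow> real \<Rightarrow> nat \<Rightarrow> real" where
  "affine_solution a b c m =
     (\<Prod>j\<in>{0..<m}. a j) + c * (\<Sum>l\<in>{0..<m}. b l * (\<Prod>j\<in>{l + 1..<m}. a j))"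

lemma affine_solution_0: "affine_solution a b c 0 = 1"
  by (simp add: affine_solution_def)

lemma affine_solution_Suc:
  "affine_solution a b c (Suc m) = a m * affine_solution a b c m + c * b m"
proof -
  have "(\<Sum>l\<in>{0..<m}. b l * (\<Prod>j\<in>{l + 1..<Suc m}. a j)) =
        (\<Sum>l\<in>{0..<m}. a m * (b l * (\<Prod>j\<in>{l + 1..<m}. a j)))"
    by (rule sum.cong) (auto simp: prod.atLeastLessThan_Suc mult_ac)
  then show ?thesis
    by (simp add: affine_solution_def sum_distrib_left[symmetric] algebra_simps)
qed

text \<open>
  Both windows share the factors \<open>v (m + 1), \<dots>, v (m + k - 1)\<close>, and replacing \<open>v (m + k)\<close> by
  \<open>v m / d\<close> supplies the missing factor of the old window. No factor is cancelled, so zeros of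
  \<open>v\<close> do no harm.
\<close>

lemma window_step:
  fixes v :: "nat \<Rightarrow> real" and d :: real
  assumes "k > 0" and v: "v (m + k) = v m / d"
  shows "(\<Prod>j<k. v (Suc m + j)) = (\<Prod>j<k. v (m + j)) / d"
proof -
  obtain k' where k': "k = Suc k'"
    using \<open>k > 0\<close> by (cases k) auto
  have "(\<Prod>j<k. v (Suc m + j)) = (\<Prod>j<k'. v (Suc m + j)) * v (m + k)"
    by (simp add: k')
  also have "\<dots> = v m * (\<Prod>j<k'. v (m + Suc j)) / d"
    by (simp add: v)
  also have "v m * (\<Prod>j<k'. v (m + Suc j)) = (\<Prod>j<k. v (m + j))"
    unfolding k' prod.lessThan_Suc_shift by simp
  finally show ?thesis .
qed

text \<open>
  Multiplying the recurrence for \<open>N\<close> out and replacing the constant \<open>V 0\<close> by \<open>V m * N m\<close> turns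
  the affine step into multiplication by the denominator \<open>a m + b m * V m\<close>.
\<close>

lemma affine_solution_step:
  fixes V a b :: "nat \<Rightarrow> real"
  defines "N \<equiv> affine_solution a b (V 0)"
  assumes nz: "\<And>m. a m + b m * V m \<noteq> 0"
    and step: "\<And>m. V (Suc m) = V m / (a m + b m * V m)"
  shows "N (Suc m) = (a m + b m * V m) * N m" and "N m \<noteq> 0"
proof -
  have mult: "N (Suc m) = (a m + b m * V m) * N m" if "V m * N m = V 0" for m
  proof -
    have "N (Suc m) = a m * N m + V m * N m * b m"
      unfolding that by (simp add: N_def affine_solution_Suc)
    then show ?thesis
      by (simp add: algebra_simps)
  qed
  have inv: "V m * N m = V 0 \<and> N m \<noteq> 0" for m
  proof (induction m)
    case 0
    show ?case by (simp add: N_def affine_solution_0)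
  next
    case (Suc m)
    then show ?case
      using mult[of m] nz[of m] step[of m] by simp
  qed
  show "N (Suc m) = (a m + b m * V m) * N m" "N m \<noteq> 0"
    using mult inv by auto
qed

lemma window_recurrence_ratio:
  fixes k :: nat and v a b :: "nat \<Rightarrow> real"
  defines "N \<equiv> affine_solution a b (\<Prod>j<k. v j)"
  assumes "k > 0"
    and nz: "\<And>m. a m + b m * (\<Prod>j<k. v (m + j)) \<noteq> 0"
    and rec: "\<And>m. v (m + k) = v m / (a m + b m * (\<Prod>j<k. v (m + j)))"
  shows "v (m + k) = v m * (N m / N (Suc m))"
proof -
  define V where "V m = (\<Prod>j<k. v (m + j))" for m
  have N: "N = affine_solution a b (V 0)"
    by (simp add: N_def V_def)
  have nzV: "a m + b m * V m \<noteq> 0" for m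
    using nz by (simp add: V_def)
  have stepV: "V (Suc m) = V m / (a m + b m * V m)" for m
    using window_step[OF \<open>k > 0\<close> rec[of m]] by (simp add: V_def)
  note NV = affine_solution_step[of a b V, OF nzV stepV, folded N]
  have "v (m + k) = v m / (a m + b m * V m)"
    using rec by (simp add: V_def)
  then show ?thesis
    using NV(2)[of m] by (simp add: NV(1))
qed

theorem mainTheorem1:
  fixes k :: nat and A B u :: "nat \<Rightarrow> real"
  assumes "k > 0"
    and "well_defined_solution k A B u"
  shows "\<forall>n::nat. \<forall>i\<in>{0..4 * k - 1}.
    u (4 * k * n + i) = u i *
      (\<Prod>s\<in>{0..<n}.
        ((\<Prod>k1\<in>{0..<k * s + i div 4}. A (4 * k1 + tau i)) +
         (\<Prod>j\<in>{0..k - 1}. u (tau i + 4 * j)) *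
         (\<Sum>l\<in>{0..<k * s + i div 4}. B (4 * l + tau i) *
            (\<Prod>k2\<in>{l + 1..<k * s + i div 4}. A (4 * k2 + tau i))))
        /
        ((\<Prod>k1\<in>{0..k * s + i div 4}. A (4 * k1 + tau i)) +
         (\<Prod>j\<in>{0..k - 1}. u (tau i + 4 * j)) *
         (\<Sum>l\<in>{0..k * s + i div 4}. B (4 * l + tau i) *
            (\<Prod>k2\<in>{l + 1..k * s + i div 4}. A (4 * k2 + tau i)))))"
proof (intro allI ballI)
  fix n i :: nat
  define t where "t = tau i"
  define q where "q = i div 4"
  define a where "a m = A (4 * m + t)" for m
  define b where "b m = B (4 * m + t)" for m
  define v where "v m = u (4 * m + t)" for m
  define N where "N = affine_solution a b (\<Prod>j<k. v j)"
  have i: "i = 4 * q + t"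
    by (simp add: q_def t_def tau_def)
  have denom: "denom k A B u (4 * m + t) = a m + b m * (\<Prod>j<k. v (m + j))" for m
  proof -
    have "(\<Prod>i=1..k. u (4 * m + t + 4 * (i - 1))) = (\<Prod>j<k. v (m + j))"
      by (rule prod.reindex_bij_witness[of _ Suc "\<lambda>i. i - 1"]) (auto simp: v_def algebra_simps)
    then show ?thesis
      by (simp add: denom_def a_def b_def)
  qed
  have sol: "denom k A B u m \<noteq> 0" "u (m + 4 * k) = u m / denom k A B u m" for m
    using assms(2) unfolding well_defined_solution_def by auto
  have nz: "a m + b m * (\<Prod>j<k. v (m + j)) \<noteq> 0" for m
    using sol(1)[of "4 * m + t"] by (simp add: denom)
  have rec: "v (m + k) = v m / (a m + b m * (\<Prod>j<k. v (m + j)))" for m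
    using sol(2)[of "4 * m + t"] unfolding denom by (simp add: v_def algebra_simps)
  note ratio = window_recurrence_ratio[of k a b v, OF assms(1) nz rec, folded N_def]
  have closed: "v (k * n + q) = v q * (\<Prod>s\<in>{0..<n}. N (k * s + q) / N (Suc (k * s + q)))"
  proof (induction n)
    case 0
    show ?case by simp
  next
    case (Suc n)
    have "v (k * Suc n + q) = v (k * n + q + k)"
      by (simp add: algebra_simps)
    also have "\<dots> = v (k * n + q) * (N (k * n + q) / N (Suc (k * n + q)))"
      by (rule ratio)
    finally show ?case
      by (simp add: Suc.IH)
  qed
  have window0: "(\<Prod>j<k. v j) = (\<Prod>j\<in>{0..k - 1}. u (t + 4 * j))"
    using assms(1) by (intro prod.cong) (auto simp: v_def add.commute)
  have "v (k * n + q) = u (4 * k * n + i)" "v q = u i"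
    by (simp_all add: v_def i algebra_simps)
  with closed show "u (4 * k * n + i) = u i *
      (\<Prod>s\<in>{0..<n}.
        ((\<Prod>k1\<in>{0..<k * s + i div 4}. A (4 * k1 + tau i)) +
         (\<Prod>j\<in>{0..k - 1}. u (tau i + 4 * j)) *
         (\<Sum>l\<in>{0..<k * s + i div 4}. B (4 * l + tau i) *
            (\<Prod>k2\<in>{l + 1..<k * s + i div 4}. A (4 * k2 + tau i))))
        /
        ((\<Prod>k1\<in>{0..k * s + i div 4}. A (4 * k1 + tau i)) +
         (\<Prod>j\<in>{0..k - 1}. u (tau i + 4 * j)) *
         (\<Sum>l\<in>{0..k * s + i div 4}. B (4 * l + tau i) *
            (\<Prod>k2\<in>{l + 1..k * s + i div 4}. A (4 * k2 + tau i)))))"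
    unfolding N_def window0 affine_solution_def a_def b_def t_def[symmetric] q_def[symmetric]
      atLeastLessThanSuc_atLeastAtMost
    by simp
qed

end
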